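(* For all integers $k\geq 2$ and $m\geq 2$ there exists a magic rectangle $MR(m,km;2k,2)$.
   Context: For positive integers $m,n,r,s$ with $mr=ns$, $r\le n$, $s\le m$, a magic rectangle $MR(m,n;r,s)$ is an $m\times n$ array in which some cells may be empty, each row contains exactly $r$ filled cells, each column contains exactly $s$ filled cells, the filled cells contain the numbers $0,1,\ldots,mr-1$, each exactly once, the sum of the entries of each row is the same for all rows, and the sum of the entries of each column is the same for all columns. *)

theory Defs
  imports Main
begin

text \<open>
  An m by n array with possibly empty cells is a function \<open>A :: nat \<Rightarrow> nat \<Rightarrow> nat option\<close>,
  where \<open>None\<close> marks an empty cell. Rows are indexed by \<open>i < m\<close> and columns by \<open>j < n\<close>;
  the values of \<open>A\<close> outside this range are irrelevant.
\<close>

definition filled_cells :: "nat \<Rightarrow> nat \<Rightarrow> (nat \<Rightarrow> nat \<Rightarrow> nat option) \<Rightarrow> (nat \<times> nat) set" where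
  "filled_cells m n A = {(i, j). i < m \<and> j < n \<and> A i j \<noteq> None}"

definition row_sum :: "nat \<Rightarrow> (nat \<Rightarrow> nat \<Rightarrow> nat option) \<Rightarrow> nat \<Rightarrow> nat" where
  "row_sum n A i = (\<Sum>j | j < n \<and> A i j \<noteq> None. the (A i j))"

definition col_sum :: "nat \<Rightarrow> (nat \<Rightarrow> nat \<Rightarrow> nat option) \<Rightarrow> nat \<Rightarrow> nat" where
  "col_sum m A j = (\<Sum>i | i < m \<and> A i j \<noteq> None. the (A i j))"

definition magic_rectangle ::
  "nat \<Rightarrow> nat \<Rightarrow> nat \<Rightarrow> nat \<Rightarrow> (nat \<Rightarrow> nat \<Rightarrow> nat option) \<Rightarrow> bool" where
  "magic_rectangle m n r s A \<longleftrightarrow>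
     0 < m \<and> 0 < n \<and> 0 < r \<and> 0 < s \<and> m * r = n * s \<and> r \<le> n \<and> s \<le> m \<and>
     (\<forall>i<m. card {j. j < n \<and> A i j \<noteq> None} = r) \<and>
     (\<forall>j<n. card {i. i < m \<and> A i j \<noteq> None} = s) \<and>
     bij_betw (\<lambda>(i, j). the (A i j)) (filled_cells m n A) {0..<m * r} \<and>
     (\<exists>c. \<forall>i<m. row_sum n A i = c) \<and>
     (\<exists>d. \<forall>j<n. col_sum m A j = d)"

end

theory Submission
  imports Defs
begin

text \<open>
  Put \<open>N = 2 k m\<close>. It suffices to distribute the numbers \<open>0, \<dots>, N - 1\<close> over the \<open>m\<close> rows so that
  every row receives \<open>2 k\<close> numbers of average \<open>(N - 1) / 2\<close> and never both \<open>x\<close> and \<open>N - 1 - x\<close>: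
  column \<open>j\<close> then holds the two numbers \<open>j\<close> and \<open>N - 1 - j\<close>.
  Such a distribution is built from the middle outwards. Shifting an existing one by \<open>L\<close> keeps its
  averages central, and if \<open>g y\<close> and \<open>h y\<close> are the rows of the new numbers \<open>y < L\<close> and \<open>N' - 1 - y\<close>,
  it is enough that the fibres of \<open>g\<close> and \<open>h\<close> over each row have the same size and the same sum.
  Pairing \<open>y\<close> with \<open>2 m - 1 - y\<close> raises \<open>k\<close> by \<open>2\<close>; three explicit blocks add \<open>3\<close>, \<open>4\<close> or \<open>5\<close> rows
  when \<open>k = 3\<close>. The case \<open>k = 3\<close>, \<open>m = 2\<close> is not of this form and is given directly.
\<close>

section \<open>Row assignments and their fibres\<close>

definition fibre :: "nat \<Rightarrow> (nat \<Rightarrow> nat) \<Rightarrow> nat \<Rightarrow> nat set" where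
  "fibre N f i = {x. x < N \<and> f x = i}"

text \<open>
  The second equation says that the average over the fibre is \<open>(N - 1) / 2\<close>, free of subtraction.
\<close>

definition balanced :: "nat \<Rightarrow> nat \<Rightarrow> (nat \<Rightarrow> nat) \<Rightarrow> bool" where
  "balanced k m f \<longleftrightarrow>
     (\<forall>x < 2 * k * m. f x < m \<and> f x \<noteq> f (2 * k * m - 1 - x)) \<and>
     (\<forall>i < m. card (fibre (2 * k * m) f i) = 2 * k \<and>
        2 * \<Sum>(fibre (2 * k * m) f i) + 2 * k = 2 * k * (2 * k * m))"

lemma finite_fibre [simp]: "finite (fibre N f i)"
  by (simp add: fibre_def)

lemma fibre_eq_set_filter: "fibre N f i = set (filter (\<lambda>x. f x = i) [0..<N])"
  by (auto simp: fibre_def)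

text \<open>In list form, sizes and sums of fibres of concrete assignments can be evaluated.\<close>

lemma card_fibre_list: "card (fibre N f i) = length (filter (\<lambda>x. f x = i) [0..<N])"
  unfolding fibre_eq_set_filter by (rule distinct_card) simp

lemma sum_fibre_list: "\<Sum>(fibre N f i) = sum_list (filter (\<lambda>x. f x = i) [0..<N])"
  unfolding fibre_eq_set_filter by (simp add: sum_list_distinct_conv_sum_set[of _ "\<lambda>x. x", simplified])

section \<open>From balanced assignments to rectangles\<close>

definition rectangle_of :: "nat \<Rightarrow> (nat \<Rightarrow> nat) \<Rightarrow> nat \<Rightarrow> nat \<Rightarrow> nat option" where
  "rectangle_of N f i j =
     (if f j = i then Some j else if f (N - 1 - j) = i then Some (N - 1 - j) else None)"

lemma magic_rectangle_of:
  assumes f: "balanced k m f" and k: "1 \<le> k" and m: "2 \<le> m"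
  shows "magic_rectangle m (k * m) (2 * k) 2 (rectangle_of (2 * k * m) f)"
proof -
  define n N A where "n = k * m" and "N = 2 * k * m" and "A = rectangle_of N f"
  have N: "N = 2 * n" by (simp add: n_def N_def)
  have npos: "0 < n" using k m by (simp add: n_def)
  have lt: "f x < m" and ne: "f x \<noteq> f (N - 1 - x)" if "x < N" for x
    using f that by (auto simp: balanced_def N_def)
  have A_eq: "A i j = (if f j = i then Some j else if f (N - 1 - j) = i then Some (N - 1 - j) else None)"
    for i j by (simp add: A_def rectangle_of_def)
  \<comment> \<open>The inverse sends \<open>x\<close> to its column, the smaller of
    \<open>x\<close> and \<open>N - 1 - x\<close>.\<close>
  have row: "bij_betw (\<lambda>j. the (A i j)) {j. j < n \<and> A i j \<noteq> None} (fibre N f i)" for i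
    using ne
    by (intro bij_betw_byWitness[where f' = "\<lambda>x. if x < n then x else N - 1 - x"])
      (auto simp: A_eq fibre_def N split: if_splits)
  have card_row: "card {j. j < n \<and> A i j \<noteq> None} = 2 * k" if "i < m" for i
    using bij_betw_same_card[OF row[of i]] f that by (simp add: balanced_def N_def)
  have sum_row: "row_sum n A i = k * N - k" if "i < m" for i
  proof -
    have "row_sum n A i = \<Sum>(fibre N f i)"
      unfolding row_sum_def by (rule sum.reindex_bij_betw[OF row])
    moreover have "2 * \<Sum>(fibre N f i) + 2 * k = 2 * k * N"
      using f that by (simp add: balanced_def N_def)
    ultimately show ?thesis by simp
  qed
  have col: "{i. i < m \<and> A i j \<noteq> None} = {f j, f (N - 1 - j)}" if "j < n" for j
    using lt[of j] lt[of "N - 1 - j"] that by (auto simp: A_eq N split: if_splits)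
  have neq: "f j \<noteq> f (N - 1 - j)" if "j < n" for j
    using ne[of j] that by (simp add: N)
  have sum_col: "col_sum m A j = N - 1" if "j < n" for j
    unfolding col_sum_def col[OF that] using neq[OF that] that by (simp add: A_eq N)
  have bij: "bij_betw (\<lambda>(i, j). the (A i j)) (filled_cells m n A) {0..<N}"
  proof (rule bij_betw_byWitness[where f' = "\<lambda>x. (f x, if x < n then x else N - 1 - x)"])
    show "(\<lambda>x. (f x, if x < n then x else N - 1 - x)) ` {0..<N} \<subseteq> filled_cells m n A"
      using lt by (auto simp: filled_cells_def A_eq N)
    show "\<forall>x\<in>{0..<N}. (\<lambda>(i, j). the (A i j)) (f x, if x < n then x else N - 1 - x) = x"
    proof
      fix x assume "x \<in> {0..<N}"
      with ne[of x] show "(\<lambda>(i, j). the (A i j)) (f x, if x < n then x else N - 1 - x) = x"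
        by (auto simp: A_eq N)
    qed
  qed (auto simp: filled_cells_def A_eq N split: if_splits)
  have card_col: "card {i. i < m \<and> A i j \<noteq> None} = 2" if "j < n" for j
    unfolding col[OF that] using neq[OF that] by simp
  have size: "m * (2 * k) = N" and "2 * k \<le> n" using m by (simp_all add: N_def n_def)
  then have "magic_rectangle m n (2 * k) 2 A"
    unfolding magic_rectangle_def size
    using k m npos card_row card_col sum_row sum_col bij by (simp add: N)
  then show ?thesis by (simp add: n_def A_def N_def)
qed

section \<open>Adding numbers at both ends\<close>

definition extend :: "nat \<Rightarrow> nat \<Rightarrow> (nat \<Rightarrow> nat) \<Rightarrow> (nat \<Rightarrow> nat) \<Rightarrow> (nat \<Rightarrow> nat) \<Rightarrow> nat \<Rightarrow> nat" where
  "extend N L g h f x =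
     (if x < L then g x else if x < N + L then f (x - L) else h (N + 2 * L - 1 - x))"

lemma fibre_extend:
  "fibre (N + 2 * L) (extend N L g h f) i =
     fibre L g i \<union> (+) L ` fibre N f i \<union> (\<lambda>y. N + 2 * L - 1 - y) ` fibre L h i" (is "?l = ?r")
proof
  show "?l \<subseteq> ?r"
  proof
    fix x assume x: "x \<in> ?l"
    consider "x < L" | "L \<le> x" "x < N + L" | "N + L \<le> x" by linarith
    then show "x \<in> ?r"
    proof cases
      case 1
      then show ?thesis using x by (simp add: fibre_def extend_def)
    next
      case 2
      then have "x - L \<in> fibre N f i" "x = L + (x - L)"
        using x by (auto simp: fibre_def extend_def)
      then show ?thesis by blast
    next
      case 3
      then have "N + 2 * L - 1 - x \<in> fibre L h i" "x = N + 2 * L - 1 - (N + 2 * L - 1 - x)"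
        using x by (auto simp: fibre_def extend_def)
      then show ?thesis by blast
    qed
  qed
  show "?r \<subseteq> ?l" by (auto simp: fibre_def extend_def)
qed

text \<open>Moving \<open>y\<close> and \<open>1\<close> to the left turns each top entry
  \<open>N + 2 * L - 1 - y\<close> into the constant \<open>N + 2 * L\<close>.\<close>

lemma
  shows card_fibre_extend: "card (fibre (N + 2 * L) (extend N L g h f) i) =
      card (fibre L g i) + card (fibre N f i) + card (fibre L h i)" (is ?card)
    and sum_fibre_extend: "\<Sum>(fibre (N + 2 * L) (extend N L g h f) i) + \<Sum>(fibre L h i) + card (fibre L h i) =
      \<Sum>(fibre L g i) + (L * card (fibre N f i) + \<Sum>(fibre N f i)) + (N + 2 * L) * card (fibre L h i)" (is ?sum)
proof -
  let ?r = "\<lambda>y. N + 2 * L - 1 - y"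
  have inj: "inj_on ?r (fibre L h i)"
    by (auto simp: inj_on_def fibre_def)
  have disj: "fibre L g i \<inter> (+) L ` fibre N f i = {}"
    "(fibre L g i \<union> (+) L ` fibre N f i) \<inter> ?r ` fibre L h i = {}"
    by (auto simp: fibre_def)
  show ?card
    unfolding fibre_extend using disj inj by (simp add: card_Un_disjoint card_image)
  have "\<Sum>(?r ` fibre L h i) + \<Sum>(fibre L h i) + card (fibre L h i)
      = (\<Sum>y\<in>fibre L h i. ?r y + y + 1)"
    by (simp only: sum.reindex[OF inj] sum.distrib o_def) simp
  also have "\<dots> = (\<Sum>y\<in>fibre L h i. N + 2 * L)"
    by (rule sum.cong) (auto simp: fibre_def)
  finally have "\<Sum>(?r ` fibre L h i) + \<Sum>(fibre L h i) + card (fibre L h i)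
      = (N + 2 * L) * card (fibre L h i)" by simp
  moreover have "\<Sum>((+) L ` fibre N f i) = L * card (fibre N f i) + \<Sum>(fibre N f i)"
    by (simp add: sum.reindex sum.distrib)
  ultimately show ?sum
    unfolding fibre_extend using disj by (simp add: sum.union_disjoint)
qed

lemma fibre_empty: "(\<And>x. x < N \<Longrightarrow> f x \<noteq> i) \<Longrightarrow> fibre N f i = {}"
  by (auto simp: fibre_def)

text \<open>In a row whose two fibres have size \<open>c\<close> and equal sums, these sums cancel:
  the \<open>2 * c\<close> new entries total \<open>c * (N' - 1)\<close> with
  \<open>N' = 2 * k' * m'\<close>, so their average is central.\<close>

lemma balanced_extend:
  assumes f: "balanced k m f" and N: "2 * k' * m' = 2 * k * m + 2 * L" and mm: "m \<le> m'"
    and g: "\<And>y. y < L \<Longrightarrow> g y < m'" and h: "\<And>y. y < L \<Longrightarrow> h y < m'"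
    and gh: "\<And>y. y < L \<Longrightarrow> g y \<noteq> h y"
    and eq: "\<And>i. i < m' \<Longrightarrow> card (fibre L g i) = card (fibre L h i)"
      "\<And>i. i < m' \<Longrightarrow> \<Sum>(fibre L g i) = \<Sum>(fibre L h i)"
    and card: "\<And>i. i < m' \<Longrightarrow> 2 * card (fibre L g i) + (if i < m then 2 * k else 0) = 2 * k'"
  shows "balanced k' m' (extend (2 * k * m) L g h f)"
  unfolding balanced_def N
proof (intro conjI allI impI)
  let ?N = "2 * k * m"
  let ?F = "extend ?N L g h f"
  have lt: "f x < m" and ne: "f x \<noteq> f (?N - 1 - x)" if "x < ?N" for x
    using f that by (auto simp: balanced_def)
  fix x assume x: "x < ?N + 2 * L"
  show "?F x < m'"
    using x g h less_le_trans[OF lt[of "x - L"] mm] by (auto simp: extend_def)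
  consider "x < L" | "L \<le> x" "x < ?N + L" | "?N + L \<le> x" by linarith
  then show "?F x \<noteq> ?F (?N + 2 * L - 1 - x)"
  proof cases
    case 1
    then show ?thesis using gh[of x] by (auto simp: extend_def)
  next
    case 2
    then have "x - L < ?N" "?N + 2 * L - 1 - x - L = ?N - 1 - (x - L)" by linarith+
    then show ?thesis using 2 ne[of "x - L"] by (auto simp: extend_def)
  next
    case 3
    then have "?N + 2 * L - 1 - x < L" using x by linarith
    then show ?thesis using 3 gh[of "?N + 2 * L - 1 - x"] by (auto simp: extend_def)
  qed
next
  let ?N = "2 * k * m"
  let ?F = "extend ?N L g h f"
  fix i assume i: "i < m'"
  define c where "c = card (fibre ?N f i)"
  \<comment> \<open>Stated through \<open>c\<close>, the central average also covers the new rows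
    \<open>i \<ge> m\<close>, where \<open>c = 0\<close>.\<close>
  have c: "c = (if i < m then 2 * k else 0) \<and> 2 * \<Sum>(fibre ?N f i) + c = c * ?N"
  proof (cases "i < m")
    case True
    then show ?thesis using f by (simp add: balanced_def c_def)
  next
    case False
    then have "fibre ?N f i = {}" using f by (intro fibre_empty) (auto simp: balanced_def)
    then show ?thesis using False by (simp add: c_def)
  qed
  have d: "2 * card (fibre L h i) + c = 2 * k'"
    using card[OF i] eq(1)[OF i] c by simp
  then show card': "card (fibre (?N + 2 * L) ?F i) = 2 * k'"
    unfolding card_fibre_extend using eq(1)[OF i] by (simp add: c_def)
  have "\<Sum>(fibre (?N + 2 * L) ?F i) + card (fibre L h i)
      = L * c + \<Sum>(fibre ?N f i) + (?N + 2 * L) * card (fibre L h i)"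
    using sum_fibre_extend[of ?N L g h f i] eq(2)[OF i] by (simp add: c_def)
  then have "2 * \<Sum>(fibre (?N + 2 * L) ?F i) + (2 * card (fibre L h i) + c)
      = 2 * L * c + c * ?N + (?N + 2 * L) * (2 * card (fibre L h i))"
    using conjunct2[OF c] by (simp add: algebra_simps)
  also have "\<dots> = (2 * card (fibre L h i) + c) * (?N + 2 * L)"
    by (simp add: algebra_simps)
  finally show "2 * \<Sum>(fibre (?N + 2 * L) ?F i) + 2 * k' = 2 * k' * (?N + 2 * L)"
    unfolding d .
qed

text \<open>All fibres of \<open>g\<close> are pairs of sum \<open>2 * m - 1\<close>, so the cyclic
  shift \<open>s\<close> of the rows, with inverse \<open>p\<close>, preserves sizes and sums; it
  has no fixed row since \<open>m \<ge> 2\<close>.\<close>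

lemma balanced_add_two:
  assumes f: "balanced k m f" and m: "2 \<le> m"
  shows "\<exists>f'. balanced (k + 2) m f'"
proof -
  define g where "g y = (if y < m then y else 2 * m - 1 - y)" for y :: nat
  define s where "s i = (if Suc i = m then 0 else Suc i)" for i
  define p where "p i = (if i = 0 then m - 1 else i - 1)" for i :: nat
  have fib_g: "fibre (2 * m) g i = {i, 2 * m - 1 - i}" if "i < m" for i
    using that by (auto simp: fibre_def g_def)
  have g_lt: "g y < m" if "y < 2 * m" for y using that m by (auto simp: g_def)
  have s_eq: "s a = i \<longleftrightarrow> a = p i" if "a < m" "i < m" for a i
    using that m by (auto simp: s_def p_def)
  have fib_h: "fibre (2 * m) (\<lambda>y. s (g y)) i = fibre (2 * m) g (p i)" if "i < m" for i
    using s_eq g_lt that by (auto simp: fibre_def)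
  have p_lt: "p i < m" if "i < m" for i using that by (auto simp: p_def)
  have card: "card (fibre (2 * m) g i) = 2" if "i < m" for i
  proof -
    have "i \<noteq> 2 * m - 1 - i" using that by linarith
    then show ?thesis unfolding fib_g[OF that] by simp
  qed
  have sum: "\<Sum>(fibre (2 * m) g i) = 2 * m - 1" if "i < m" for i
  proof -
    have "i \<noteq> 2 * m - 1 - i" using that by linarith
    then show ?thesis unfolding fib_g[OF that] using that by simp
  qed
  have "balanced (k + 2) m (extend (2 * k * m) (2 * m) g (\<lambda>y. s (g y)) f)"
  proof (rule balanced_extend[OF f])
    show "g y \<noteq> s (g y)" "s (g y) < m" if "y < 2 * m" for y
      using g_lt[OF that] m by (auto simp: s_def)
  qed (use g_lt in \<open>simp_all add: fib_h card sum p_lt add_mult_distrib\<close>)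
  then show ?thesis by blast
qed

section \<open>Blocks for \<open>k = 3\<close> and the final induction\<close>

lemma fibre_add: "fibre L (\<lambda>y. m + u y) i = (if m \<le> i then fibre L u (i - m) else {})"
  by (auto simp: fibre_def)

lemma balanced_three_add_rows:
  assumes f: "balanced 3 m f"
    and lt: "\<forall>y < 3 * r. u y < r \<and> v y < r \<and> u y \<noteq> v y"
    and fib: "\<forall>i < r. card (fibre (3 * r) u i) = 3 \<and> card (fibre (3 * r) v i) = 3 \<and>
      \<Sum>(fibre (3 * r) u i) = \<Sum>(fibre (3 * r) v i)"
  shows "\<exists>f'. balanced 3 (m + r) f'"
proof -
  have "balanced 3 (m + r) (extend (2 * 3 * m) (3 * r) (\<lambda>y. m + u y) (\<lambda>y. m + v y) f)"
    by (rule balanced_extend[OF f]) (use lt fib in \<open>auto simp: fibre_add\<close>)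
  then show ?thesis by blast
qed

definition block_check :: "nat \<Rightarrow> nat list \<Rightarrow> nat list \<Rightarrow> bool" where
  "block_check r us vs \<longleftrightarrow>
     (\<forall>y \<in> set [0..<3 * r]. us ! y < r \<and> vs ! y < r \<and> us ! y \<noteq> vs ! y) \<and>
     (\<forall>i \<in> set [0..<r]. length (filter (\<lambda>x. us ! x = i) [0..<3 * r]) = 3 \<and>
        length (filter (\<lambda>x. vs ! x = i) [0..<3 * r]) = 3 \<and>
        sum_list (filter (\<lambda>x. us ! x = i) [0..<3 * r]) = sum_list (filter (\<lambda>x. vs ! x = i) [0..<3 * r]))"

lemma balanced_three_add_block:
  assumes "balanced 3 m f" and "block_check r us vs"
  shows "\<exists>f'. balanced 3 (m + r) f'"
  by (rule balanced_three_add_rows[OF assms(1), of r "(!) us" "(!) vs"])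
    (use assms(2) in \<open>simp_all add: block_check_def card_fibre_list sum_fibre_list\<close>)

text \<open>
  For \<open>r = 3, 5\<close> the rows partition \<open>0, \<dots>, 3 r - 1\<close> into triples of equal sum, shifted cyclically in
  the second list. For even \<open>r\<close> there are none, as \<open>3 (3 r - 1) / 2\<close> is not an integer;
  for \<open>r = 4\<close> two pairs of triples of equal sum, \<open>{0,4,5}, {1,2,6}\<close> and \<open>{3,10,11}, {7,8,9}\<close>, are swapped instead.
\<close>

lemma block_3: "block_check 3 [0,1,2,2,0,1,1,2,0] [1,2,0,0,1,2,2,0,1]"
  by code_simp

lemma block_4: "block_check 4 [0,1,1,2,0,0,1,3,3,3,2,2] [1,0,0,3,1,1,0,2,2,2,3,3]"
  by code_simp

lemma block_5: "block_check 5 [0,1,2,3,4,3,4,0,1,2,2,4,1,3,0] [1,2,3,4,0,4,0,1,2,3,3,0,2,4,1]"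
  by code_simp

text \<open>With two rows and \<open>L = 6\<close>, \<open>g y \<noteq> h y\<close> would force both
  fibres of \<open>g\<close> to have equal sums, but \<open>0 + ... + 5 = 15\<close> is odd. Here
  each row has sum \<open>33 = 6 * 11 / 2\<close>.\<close>

lemma balanced_three_two: "balanced 3 2 ((!) [0,1,0,1,1,1,0,0,0,1,0,1])"
proof -
  let ?f = "(!) [0,1,0,1,1,1,0,0,0,1,0,1] :: nat \<Rightarrow> nat"
  have "\<forall>x \<in> set [0..<12]. ?f x < 2 \<and> ?f x \<noteq> ?f (11 - x)" by code_simp
  moreover have "\<forall>i \<in> set [0..<2]. length (filter (\<lambda>x. ?f x = i) [0..<12]) = 6 \<and>
      sum_list (filter (\<lambda>x. ?f x = i) [0..<12]) = 33" by code_simp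
  ultimately show ?thesis
    unfolding balanced_def card_fibre_list sum_fibre_list by simp
qed

lemma balanced_three:
  assumes "2 \<le> m"
  shows "\<exists>f. balanced 3 m f"
proof (cases "m = 2")
  case True
  then show ?thesis using balanced_three_two by blast
next
  case False
  with assms have "3 \<le> m" by simp
  then show ?thesis
  proof (induction m rule: less_induct)
    case (less m)
    \<comment> \<open>Without rows there are no numbers, so a single block gives each base
      case.\<close>
    have zero: "balanced 3 0 f" for f by (simp add: balanced_def)
    consider "m = 3" | "m = 4" | "m = 5" | "6 \<le> m" using less.prems by linarith
    then show ?case
    proof cases
      case 1
      then show ?thesis using balanced_three_add_block[OF zero block_3] by simp
    next
      case 2
      then show ?thesis using balanced_three_add_block[OF zero block_4] by simp
    next
      case 3
      then show ?thesis using balanced_three_add_block[OF zero block_5] by simp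
    next
      case 4
      then obtain f where "balanced 3 (m - 3) f" using less.IH[of "m - 3"] by fastforce
      from balanced_three_add_block[OF this block_3] show ?thesis using 4 by simp
    qed
  qed
qed

text \<open>Steps of two start from the empty assignment for even \<open>k\<close> and from
  \<open>k = 3\<close> for odd \<open>k\<close>. For \<open>k = 1\<close> a row would hold two
  numbers of sum \<open>N - 1\<close>, a forbidden pair.\<close>

lemma balanced_exists:
  assumes m: "2 \<le> m" and "k \<noteq> 1"
  shows "\<exists>f. balanced k m f"
  using \<open>k \<noteq> 1\<close>
proof (induction k rule: less_induct)
  case (less k)
  consider "k = 0" | "k = 3" | "2 \<le> k" "k - 2 \<noteq> 1" using less.prems by linarith
  then show ?case
  proof cases
    case 1
    then show ?thesis by (simp add: balanced_def fibre_def)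
  next
    case 2
    then show ?thesis using balanced_three[OF m] by simp
  next
    case 3
    then obtain f where "balanced (k - 2) m f" using less.IH[of "k - 2"] by auto
    from balanced_add_two[OF this m] show ?thesis using 3 by (metis le_add_diff_inverse2)
  qed
qed

theorem theorem4:
  fixes k m :: nat
  assumes "k \<ge> 2" and "m \<ge> 2"
  shows "\<exists>A. magic_rectangle m (k * m) (2 * k) 2 A"
proof -
  obtain f where "balanced k m f" using balanced_exists[of m k] assms by auto
  then show ?thesis using magic_rectangle_of[of k m f] assms by auto
qed

end
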